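(* Let $r\ge0$, $p\ge1$, $\rho_h>0$, $d_h\ge0$ ($1\le h\le r$), $\widehat a_*\in\mathbb R$, and let $\xi_1,\dots,\xi_p\in\mathbb R$ be pairwise distinct with $\xi_i+\rho_h>0$ for all $i,h$. Let $\boldsymbol\lambda=(\boldsymbol n,\eta)\in\mathbb N_0^r\times\mathbb N_0$ have entries pairwise differing by at most one, $N=|\boldsymbol n|+\eta$, and let $\boldsymbol m\in\mathbb N_0^p$ with $|\boldsymbol m|=N+1$. Let $A^{(i),\mathrm H}_{\boldsymbol\lambda,\boldsymbol m}$ be the polynomial components of the Hermite $A$-form (see context). For $m_i\ge1$ put $$G_i(z)=\frac{\prod_{h=1}^r(\rho_h+z)^{n_h+d_h}}{\prod_{k\ne i}(\xi_k-z)^{m_k}},\qquad u_i(t)=t-\widehat a_*-\xi_i/2,$$ $$\boldsymbol b_i=\bigl((-n_h-d_h)_{h=1}^r,(m_k)_{k\ne i}\bigr),\qquad\boldsymbol x_i=\Bigl(\bigl(-\tfrac1{\rho_h+\xi_i}\bigr)_{h=1}^r,\bigl(\tfrac1{\xi_k-\xi_i}\bigr)_{k\ne i}\Bigr).$$ Then, for $m_i\ge1$, $$A^{(i),\mathrm H}_{\boldsymbol\lambda,\boldsymbol m}(t)=\frac{(-1)^{m_i}\mathrm e^{-\widehat a_*\xi_i-\xi_i^2/4}G_i(\xi_i)}{\prod_{h=1}^r\rho_h^{d_h}}\,\mathfrak E_{m_i-1}(\boldsymbol b_i,\boldsymbol x_i;u_i(t),-1/4).$$ Thus each component is one terminating Srivastava–Daoust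 function of $r+p$ arguments, multiplied by the displayed constant.
   Context: Hermite $A$-form: with $L_F(z)=\mathrm e^{\widehat a_*z+z^2/4}\prod_{h=1}^r(\rho_h/(\rho_h+z))^{d_h}$ (powers positive on the real axis to the right of every $-\rho_h$), $$\mathcal A^{\mathrm H}_{\boldsymbol\lambda,\boldsymbol m}(t)=\frac1{2\pi\mathrm i}\oint_{\Sigma_\xi}\frac{\mathrm e^{zt}\prod_{h=1}^r(\rho_h+z)^{n_h}}{L_F(z)\prod_{i=1}^p(\xi_i-z)^{m_i}}\,\mathrm dz=\sum_{i=1}^pA^{(i),\mathrm H}_{\boldsymbol\lambda,\boldsymbol m}(t)\mathrm e^{\xi_it},$$ where $\Sigma_\xi$ is a positively oriented contour enclosing $\xi_1,\dots,\xi_p$ and lying, when $r>0$, in $\operatorname{Re}z>-\min_h\rho_h$; $A^{(i),\mathrm H}_{\boldsymbol\lambda,\boldsymbol m}(t)\mathrm e^{\xi_it}$ is the residue contribution at $\xi_i$, and $A^{(i),\mathrm H}_{\boldsymbol\lambda,\boldsymbol m}$ is a polynomial of degree $m_i-1$ (zero if $m_i=0$). For $m\in\mathbb N_0$, $\boldsymbol b,\boldsymbol x\in\mathbb C^R$, $v,w\in\mathbb C$, $$\mathfrak E_m(\boldsymbol b,\boldsymbol x;v,w)=\sum_{\substack{\boldsymbol\alpha\in\mathbb N_0^R,\,a\in\mathbb N_0\\|\boldsymbol\alpha|+2a\le m}}\frac{v^{m-|\boldsymbol\alpha|-2a}w^a}{(m-|\boldsymbol\alpha|-2a)!\,a!}\prod_{h=1}^R\frac{(b_h)_{\alpha_h}x_h^{\alpha_h}}{\alpha_h!},$$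 with $(b)_k=b(b+1)\cdots(b+k-1)$. For $v\ne0$ it equals $\frac{v^m}{m!}$ times the terminating Srivastava–Daoust function of $R+1$ arguments $$\sum_{\boldsymbol\alpha,a}(-m)_{|\boldsymbol\alpha|+2a}\prod_{h=1}^R\frac{(b_h)_{\alpha_h}}{\alpha_h!}\Bigl(-\frac{x_h}v\Bigr)^{\alpha_h}\frac1{a!}\Bigl(\frac w{v^2}\Bigr)^a;$$ the finite polynomial supplies the value at $v=0$. *)

theory Defs
  imports "HOL-Complex_Analysis.Complex_Analysis"
begin

text \<open>
  Vectors indexed by \<open>1,\<dots>,r\<close> or \<open>1,\<dots>,p\<close> are functions on \<open>nat\<close> of which only the values on
  \<open>{1..r}\<close> resp. \<open>{1..p}\<close> matter. Vectors of \<open>\<complex>\<^sup>R\<close> and multi-indices of \<open>\<nat>\<^sup>R\<close> in the hypergeometric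
  sums are lists of length \<open>R\<close>, so that vectors can be concatenated.
\<close>

section \<open>The Hermite A-form\<close>

text \<open>
  For \<open>Re z > - \<rho>\<^sub>h\<close> the base \<open>\<rho>\<^sub>h / (\<rho>\<^sub>h + z)\<close> has positive real part, so the principal power is the
  branch that is positive on the real axis to the right of every \<open>- \<rho>\<^sub>h\<close>.
\<close>

definition hermite_L :: "nat \<Rightarrow> (nat \<Rightarrow> real) \<Rightarrow> (nat \<Rightarrow> real) \<Rightarrow> real \<Rightarrow> complex \<Rightarrow> complex" where
  "hermite_L r \<rho> d a z =
     exp (of_real a * z + z\<^sup>2 / 4) *
     (\<Prod>h\<in>{1..r}. (of_real (\<rho> h) / (of_real (\<rho> h) + z)) powr of_real (d h))"

definition hermite_integrand ::
  "nat \<Rightarrow> (nat \<Rightarrow> real) \<Rightarrow> (nat \<Rightarrow> real) \<Rightarrow> real \<Rightarrow> nat \<Rightarrow> (nat \<Rightarrow> real) \<Rightarrow>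
   (nat \<Rightarrow> nat) \<Rightarrow> (nat \<Rightarrow> nat) \<Rightarrow> complex \<Rightarrow> complex \<Rightarrow> complex" where
  "hermite_integrand r \<rho> d a p \<xi> n m t z =
     exp (z * t) * (\<Prod>h\<in>{1..r}. (of_real (\<rho> h) + z) ^ n h) /
     (hermite_L r \<rho> d a z * (\<Prod>i\<in>{1..p}. (of_real (\<xi> i) - z) ^ m i))"

definition hermite_contour ::
  "nat \<Rightarrow> (nat \<Rightarrow> real) \<Rightarrow> nat \<Rightarrow> (nat \<Rightarrow> real) \<Rightarrow> (real \<Rightarrow> complex) \<Rightarrow> bool" where
  "hermite_contour r \<rho> p \<xi> \<gamma> \<longleftrightarrow>
     valid_path \<gamma> \<and> simple_path \<gamma> \<and> pathfinish \<gamma> = pathstart \<gamma> \<and>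
     (\<forall>i\<in>{1..p}. of_real (\<xi> i) \<notin> path_image \<gamma> \<and> winding_number \<gamma> (of_real (\<xi> i)) = 1) \<and>
     (\<forall>z\<in>path_image \<gamma>. \<forall>h\<in>{1..r}. Re z > - \<rho> h)"

definition hermite_A_form ::
  "nat \<Rightarrow> (nat \<Rightarrow> real) \<Rightarrow> (nat \<Rightarrow> real) \<Rightarrow> real \<Rightarrow> nat \<Rightarrow> (nat \<Rightarrow> real) \<Rightarrow>
   (nat \<Rightarrow> nat) \<Rightarrow> (nat \<Rightarrow> nat) \<Rightarrow> (real \<Rightarrow> complex) \<Rightarrow> complex \<Rightarrow> complex" where
  "hermite_A_form r \<rho> d a p \<xi> n m \<gamma> t =
     1 / (2 * of_real pi * \<i>) * contour_integral \<gamma> (hermite_integrand r \<rho> d a p \<xi> n m t)"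

text \<open>
  The \<open>i\<close>-th component: its product with \<open>exp (\<xi>\<^sub>i t)\<close> is the residue contribution at \<open>\<xi>\<^sub>i\<close>.
\<close>

definition hermite_A ::
  "nat \<Rightarrow> (nat \<Rightarrow> real) \<Rightarrow> (nat \<Rightarrow> real) \<Rightarrow> real \<Rightarrow> nat \<Rightarrow> (nat \<Rightarrow> real) \<Rightarrow>
   (nat \<Rightarrow> nat) \<Rightarrow> (nat \<Rightarrow> nat) \<Rightarrow> nat \<Rightarrow> complex \<Rightarrow> complex" where
  "hermite_A r \<rho> d a p \<xi> n m i t =
     exp (- (of_real (\<xi> i) * t)) *
     residue (hermite_integrand r \<rho> d a p \<xi> n m t) (of_real (\<xi> i))"

lemma hermite_L_base:
  assumes "\<rho> > 0" "Re z > - \<rho>"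
  shows "complex_of_real \<rho> + z \<noteq> 0"
    and "complex_of_real \<rho> / (complex_of_real \<rho> + z) \<notin> \<real>\<^sub>\<le>\<^sub>0"
proof -
  have pos: "Re (complex_of_real \<rho> + z) > 0"
    using assms(2) by simp
  then show nz: "complex_of_real \<rho> + z \<noteq> 0"
    by (metis less_irrefl zero_complex.sel(1))
  have "Re (complex_of_real \<rho> / (complex_of_real \<rho> + z)) =
        \<rho> * Re (complex_of_real \<rho> + z) / (cmod (complex_of_real \<rho> + z))\<^sup>2"
    by (simp add: Re_divide cmod_power2)
  also have "\<dots> > 0"
    using pos assms(1) nz by (intro divide_pos_pos mult_pos_pos) auto
  finally show "complex_of_real \<rho> / (complex_of_real \<rho> + z) \<notin> \<real>\<^sub>\<le>\<^sub>0"
    by (simp add: complex_nonpos_Reals_iff)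
qed

lemma hermite_L_nonzero:
  assumes "\<And>h. h \<in> {1..r} \<Longrightarrow> \<rho> h > 0" "\<forall>h\<in>{1..r}. Re z > - \<rho> h"
  shows "hermite_L r \<rho> d a z \<noteq> 0"
proof -
  have "complex_of_real (\<rho> h) / (complex_of_real (\<rho> h) + z) \<noteq> 0" if "h \<in> {1..r}" for h
    using hermite_L_base(2)[of "\<rho> h" z] assms that by force
  then show ?thesis
    unfolding hermite_L_def by (simp add: prod_zero_iff del: divide_eq_0_iff atLeastAtMost_iff)
qed

lemma hermite_L_holomorphic:
  assumes "\<And>h. h \<in> {1..r} \<Longrightarrow> \<rho> h > 0"
  shows "hermite_L r \<rho> d a holomorphic_on {z. \<forall>h\<in>{1..r}. Re z > - \<rho> h}"
proof -
  have "(\<lambda>z. (of_real (\<rho> h) / (of_real (\<rho> h) + z)) powr complex_of_real (d h))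
        holomorphic_on {z. \<forall>h\<in>{1..r}. Re z > - \<rho> h}" if h: "h \<in> {1..r}" for h
  proof (rule holomorphic_on_powr)
    show "(\<lambda>z. of_real (\<rho> h) / (of_real (\<rho> h) + z)) holomorphic_on {z. \<forall>h\<in>{1..r}. Re z > - \<rho> h}"
      using hermite_L_base(1)[OF assms[OF h]] h
      by (intro holomorphic_on_divide holomorphic_on_add holomorphic_on_const holomorphic_on_ident) blast
  qed (use hermite_L_base(2)[OF assms[OF h]] h in \<open>auto intro: holomorphic_on_const\<close>)
  then show ?thesis
    unfolding hermite_L_def[abs_def]
    by (intro holomorphic_on_mult holomorphic_on_prod) (intro holomorphic_intros, auto)
qed

text \<open>The components decompose the contour integral, whatever the admissible contour.\<close>

lemma hermite_A_form_eq_sum: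
  assumes \<rho>: "\<And>h. h \<in> {1..r} \<Longrightarrow> \<rho> h > 0"
    and \<xi>: "inj_on \<xi> {1..p}" "\<And>i h. i \<in> {1..p} \<Longrightarrow> h \<in> {1..r} \<Longrightarrow> \<xi> i + \<rho> h > 0"
    and \<gamma>: "hermite_contour r \<rho> p \<xi> \<gamma>"
  shows "hermite_A_form r \<rho> d a p \<xi> n m \<gamma> t =
         (\<Sum>i\<in>{1..p}. hermite_A r \<rho> d a p \<xi> n m i t * exp (of_real (\<xi> i) * t))"
proof -
  define S where "S = {z. \<forall>h\<in>{1..r}. Re z > - \<rho> h}"
  define P where "P = (\<lambda>i. complex_of_real (\<xi> i)) ` {1..p}"
  let ?f = "hermite_integrand r \<rho> d a p \<xi> n m t"
  have S: "S = (\<Inter>h\<in>{1..r}. {z. Re z > - \<rho> h})"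
    by (auto simp: S_def)
  have op: "open S"
    unfolding S by (intro open_INT ballI open_halfspace_Re_gt) auto
  have cv: "convex S"
    unfolding S by (intro convex_INT convex_halfspace_Re_gt)
  have inj: "inj_on (\<lambda>i. complex_of_real (\<xi> i)) {1..p}"
    using comp_inj_on[OF \<xi>(1) inj_on_subset[OF inj_of_real subset_UNIV]]
    by (simp only: comp_def)
  have L: "hermite_L r \<rho> d a holomorphic_on S - P"
    by (rule holomorphic_on_subset[OF hermite_L_holomorphic[OF \<rho>]]) (auto simp: S_def)
  have nz: "hermite_L r \<rho> d a z * (\<Prod>i\<in>{1..p}. (of_real (\<xi> i) - z) ^ m i) \<noteq> 0"
    if z: "z \<in> S - P" for z
  proof -
    have "hermite_L r \<rho> d a z \<noteq> 0"
      by (rule hermite_L_nonzero[OF \<rho>]) (use z in \<open>auto simp: S_def\<close>)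
    moreover have "(\<Prod>i\<in>{1..p}. (of_real (\<xi> i) - z) ^ m i) \<noteq> 0"
      using z unfolding P_def by (auto simp: prod_zero_iff)
    ultimately show ?thesis
      by simp
  qed
  have hol: "?f holomorphic_on S - P"
    unfolding hermite_integrand_def[abs_def]
    by (rule holomorphic_on_divide[OF _ holomorphic_on_mult[OF L] nz]) (intro holomorphic_intros)+
  have img: "path_image \<gamma> \<subseteq> S - P"
    using \<gamma> by (auto simp: hermite_contour_def S_def P_def)
  have path: "path \<gamma>" "valid_path \<gamma>" "pathfinish \<gamma> = pathstart \<gamma>"
    using \<gamma> by (auto simp: hermite_contour_def valid_path_imp_path)
  have "contour_integral \<gamma> ?f =
        2 * pi * \<i> * (\<Sum>q\<in>P. winding_number \<gamma> q * residue ?f q)"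
    by (rule Residue_theorem[OF op convex_connected[OF cv] _ hol path(2,3) img])
      (use winding_number_zero_outside[OF path(1) cv path(3)] img in \<open>auto simp: P_def\<close>)
  also have "(\<Sum>q\<in>P. winding_number \<gamma> q * residue ?f q) =
             (\<Sum>i\<in>{1..p}. residue ?f (of_real (\<xi> i)))"
    unfolding P_def sum.reindex[OF inj] comp_def
    using \<gamma> by (intro sum.cong) (auto simp: hermite_contour_def)
  finally have "hermite_A_form r \<rho> d a p \<xi> n m \<gamma> t =
                (\<Sum>i\<in>{1..p}. residue ?f (of_real (\<xi> i)))"
    by (simp add: hermite_A_form_def)
  also have "\<dots> = (\<Sum>i\<in>{1..p}. hermite_A r \<rho> d a p \<xi> n m i t * exp (of_real (\<xi> i) * t))"
    by (rule sum.cong) (simp_all add: hermite_A_def exp_minus)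
  finally show ?thesis .
qed

section \<open>The finite polynomial and the terminating Srivastava--Daoust function\<close>

definition frakE :: "nat \<Rightarrow> complex list \<Rightarrow> complex list \<Rightarrow> complex \<Rightarrow> complex \<Rightarrow> complex" where
  "frakE m b x v w =
     (\<Sum>(\<alpha>, a) \<in> {(\<alpha> :: nat list, a :: nat). length \<alpha> = length b \<and> sum_list \<alpha> + 2 * a \<le> m}.
        v ^ (m - sum_list \<alpha> - 2 * a) * w ^ a / (fact (m - sum_list \<alpha> - 2 * a) * fact a) *
        (\<Prod>h<length b. pochhammer (b ! h) (\<alpha> ! h) * (x ! h) ^ (\<alpha> ! h) / fact (\<alpha> ! h)))"

text \<open>
  The arguments are the entries of \<open>y\<close> followed by \<open>s\<close>. The sum is over all multi-indices; it
  terminates because \<open>pochhammer (- of_nat m) k = 0\<close> for \<open>k > m\<close>.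
\<close>

definition srivastava_daoust ::
  "nat \<Rightarrow> complex list \<Rightarrow> complex list \<Rightarrow> complex \<Rightarrow> complex" where
  "srivastava_daoust m b y s =
     (\<Sum>\<^sub>\<infinity>(\<alpha>, a) \<in> {\<alpha> :: nat list. length \<alpha> = length b} \<times> (UNIV :: nat set).
        pochhammer (- of_nat m) (sum_list \<alpha> + 2 * a) *
        (\<Prod>h<length b. pochhammer (b ! h) (\<alpha> ! h) / fact (\<alpha> ! h) * (y ! h) ^ (\<alpha> ! h)) *
        (1 / fact a) * s ^ a)"

section \<open>Data of the explicit formula\<close>

definition hermite_G ::
  "nat \<Rightarrow> (nat \<Rightarrow> real) \<Rightarrow> (nat \<Rightarrow> real) \<Rightarrow> nat \<Rightarrow> (nat \<Rightarrow> real) \<Rightarrow>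
   (nat \<Rightarrow> nat) \<Rightarrow> (nat \<Rightarrow> nat) \<Rightarrow> nat \<Rightarrow> complex \<Rightarrow> complex" where
  "hermite_G r \<rho> d p \<xi> n m i z =
     (\<Prod>h\<in>{1..r}. (of_real (\<rho> h) + z) powr of_real (real (n h) + d h)) /
     (\<Prod>k\<in>{1..p} - {i}. (of_real (\<xi> k) - z) ^ m k)"

definition hermite_u :: "real \<Rightarrow> (nat \<Rightarrow> real) \<Rightarrow> nat \<Rightarrow> complex \<Rightarrow> complex" where
  "hermite_u a \<xi> i t = t - of_real a - of_real (\<xi> i) / 2"

definition hermite_b ::
  "nat \<Rightarrow> (nat \<Rightarrow> real) \<Rightarrow> nat \<Rightarrow> (nat \<Rightarrow> nat) \<Rightarrow> (nat \<Rightarrow> nat) \<Rightarrow> nat \<Rightarrow> complex list" where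
  "hermite_b r d p n m i =
     map (\<lambda>h. - of_nat (n h) - of_real (d h)) [1..<Suc r] @
     map (\<lambda>k. of_nat (m k)) (filter (\<lambda>k. k \<noteq> i) [1..<Suc p])"

definition hermite_x ::
  "nat \<Rightarrow> (nat \<Rightarrow> real) \<Rightarrow> nat \<Rightarrow> (nat \<Rightarrow> real) \<Rightarrow> nat \<Rightarrow> complex list" where
  "hermite_x r \<rho> p \<xi> i =
     map (\<lambda>h. - 1 / of_real (\<rho> h + \<xi> i)) [1..<Suc r] @
     map (\<lambda>k. 1 / of_real (\<xi> k - \<xi> i)) (filter (\<lambda>k. k \<noteq> i) [1..<Suc p])"

end

theory Submission
  imports Defs
begin

text \<open>
  With \<open>z = \<xi>\<^sub>i + s\<close>, the integrand is a constant times
  \<open>s ^ (- m\<^sub>i) * exp (u s - s\<^sup>2 / 4) * (\<Prod>h. (1 - x\<^sub>h s) powr (- b\<^sub>h))\<close>: each power of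
  \<open>\<rho>\<^sub>h + z\<close> contributes the pair \<open>(- n\<^sub>h - d\<^sub>h, - 1 / (\<rho>\<^sub>h + \<xi>\<^sub>i))\<close>, and each other pole the pair
  \<open>(m\<^sub>k, 1 / (\<xi>\<^sub>k - \<xi>\<^sub>i))\<close>. The residue is the coefficient of \<open>s ^ (m\<^sub>i - 1)\<close>, and expanding the
  factors by the binomial and exponential series exhibits it as the finite polynomial.
\<close>

section \<open>Power series of the factors\<close>

definition pochhammer_fps :: "complex \<Rightarrow> complex \<Rightarrow> complex fps" where
  "pochhammer_fps b x = Abs_fps (\<lambda>k. pochhammer b k * x ^ k / fact k)"

text \<open>This is Newton's binomial series in \<open>- x * s\<close>: the sign
  \<open>(- 1) ^ k\<close> in the generalised binomial coefficient of \<open>- b\<close> cancels the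
  one in \<open>(- x) ^ k\<close>, leaving the rising factorial.\<close>

lemma has_fps_expansion_pochhammer_fps:
  "(\<lambda>s. (1 - x * s) powr (- b)) has_fps_expansion pochhammer_fps b x"
proof -
  have "((\<lambda>s. (1 + s) powr (- b)) \<circ> (\<lambda>s. - x * s)) has_fps_expansion
        fps_compose (fps_binomial (- b)) (fps_const (- x) * fps_X)"
    by (intro has_fps_expansion_compose has_fps_expansion_binomial_complex
        has_fps_expansion_cmult_left has_fps_expansion_fps_X) simp
  moreover have "fps_compose (fps_binomial (- b)) (fps_const (- x) * fps_X) = pochhammer_fps b x"
    unfolding fps_compose_linear pochhammer_fps_def
    by (rule fps_ext) (simp add: gbinomial_pochhammer flip: power_mult_distrib)
  ultimately show ?thesis
    by (simp add: o_def)
qed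

text \<open>Variant of \<open>fps_prod_nth\<close> for a range that may be empty. The value
  \<open>R = 0\<close> does occur: for \<open>r = 0\<close> and \<open>p = 1\<close> the parameter
  lists are empty.\<close>

lemma fps_prod_nth_lessThan:
  fixes f :: "nat \<Rightarrow> 'a :: comm_ring_1 fps"
  shows "fps_nth (\<Prod>h<R. f h) k = (\<Sum>\<alpha>\<in>natpermute k R. \<Prod>h<R. fps_nth (f h) (\<alpha> ! h))"
proof (cases R)
  case 0
  then show ?thesis
    by (cases k) (simp_all add: natpermute_def conj_commute cong: conj_cong)
next
  case (Suc R')
  then have "{..<R} = {0..R'}"
    by auto
  then show ?thesis
    using fps_prod_nth[of f R' k] Suc by simp
qed

text \<open>The series is that of \<open>exp (v * s + w * s ^ 2)\<close>, so \<open>fact l\<close>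
  times the coefficient is a two-variable Hermite polynomial. Only even indices
  \<open>i = 2 * a\<close> of the first factor contribute to the Cauchy product.\<close>

lemma fps_nth_exp_quadratic:
  fixes v w :: complex
  shows "fps_nth ((fps_exp w oo fps_X ^ 2) * fps_exp v) l =
    (\<Sum>a\<le>l div 2. v ^ (l - 2 * a) * w ^ a / (fact (l - 2 * a) * fact a))"
proof -
  have "fps_nth ((fps_exp w oo fps_X ^ 2) * fps_exp v) l =
    (\<Sum>i=0..l. (if 2 dvd i then w ^ (i div 2) / fact (i div 2) else 0) * (v ^ (l - i) / fact (l - i)))"
    unfolding fps_mult_nth fps_nth_compose_X_power by (intro sum.cong) auto
  also have "\<dots> = (\<Sum>i\<in>(*) 2 ` {..l div 2}.
      (if 2 dvd i then w ^ (i div 2) / fact (i div 2) else 0) * (v ^ (l - i) / fact (l - i)))"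
    by (intro sum.mono_neutral_right) (auto elim!: dvdE)
  also have "\<dots> = (\<Sum>a\<le>l div 2. v ^ (l - 2 * a) * w ^ a / (fact (l - 2 * a) * fact a))"
    by (subst sum.reindex) (auto simp: inj_on_def mult_ac)
  finally show ?thesis .
qed

section \<open>The finite polynomial as a series coefficient\<close>

text \<open>Sorting by \<open>k = sum_list \<alpha>\<close>, the degree taken up by the binomial
  factors, leaves degree \<open>m - k\<close> for the exponential ones. This is the shape of a
  Cauchy product, and it also gives finiteness.\<close>

lemma frakE_indices_eq_UN:
  "{(\<alpha> :: nat list, a :: nat). length \<alpha> = R \<and> sum_list \<alpha> + 2 * a \<le> m} =
   (\<Union>k\<in>{0..m}. natpermute k R \<times> {..(m - k) div 2})"
  by (auto simp: natpermute_def)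

lemma finite_frakE_indices:
  "finite {(\<alpha> :: nat list, a :: nat). length \<alpha> = R \<and> sum_list \<alpha> + 2 * a \<le> m}"
  unfolding frakE_indices_eq_UN by (intro finite_UN_I finite_cartesian_product natpermute_finite) auto

text \<open>Generating function of \<open>frakE\<close>: the product of all
  \<open>(1 - x\<^sub>h s) powr (- b\<^sub>h)\<close> and \<open>exp (v s + w s\<^sup>2)\<close>.
  For each fixed \<open>k\<close> the double sum factors into a sum over \<open>\<alpha>\<close> and
  a sum over \<open>a\<close>.\<close>

lemma frakE_eq_fps_nth:
  "frakE m b x v w =
     fps_nth ((\<Prod>h<length b. pochhammer_fps (b ! h) (x ! h)) * ((fps_exp w oo fps_X ^ 2) * fps_exp v)) m"
proof -
  let ?R = "length b"
  let ?Q = "\<lambda>\<alpha>. \<Prod>h<?R. pochhammer (b ! h) (\<alpha> ! h) * (x ! h) ^ (\<alpha> ! h) / fact (\<alpha> ! h)"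
  let ?q = "\<lambda>l a. v ^ (l - 2 * a) * w ^ a / (fact (l - 2 * a) * fact a)"
  have "frakE m b x v w =
    (\<Sum>k=0..m. \<Sum>(\<alpha>, a)\<in>natpermute k ?R \<times> {..(m - k) div 2}. ?q (m - sum_list \<alpha>) a * ?Q \<alpha>)"
    unfolding frakE_def frakE_indices_eq_UN
    \<comment> \<open>The blocks are disjoint because the entries of \<open>\<alpha>\<close>
      determine \<open>k\<close>.\<close>
    by (rule sum.UNION_disjoint) (auto simp: natpermute_finite, auto simp: natpermute_def)
  also have "\<dots> = (\<Sum>k=0..m. (\<Sum>\<alpha>\<in>natpermute k ?R. ?Q \<alpha>) * (\<Sum>a\<le>(m - k) div 2. ?q (m - k) a))"
    unfolding sum_product sum.cartesian_product[symmetric]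
    by (intro sum.cong refl) (simp add: natpermute_def mult_ac)
  also have "\<dots> = fps_nth ((\<Prod>h<?R. pochhammer_fps (b ! h) (x ! h)) *
      ((fps_exp w oo fps_X ^ 2) * fps_exp v)) m"
    unfolding fps_mult_nth[of _ "(fps_exp w oo fps_X ^ 2) * fps_exp v"]
    by (simp add: fps_nth_exp_quadratic fps_prod_nth_lessThan pochhammer_fps_def)
  finally show ?thesis .
qed

section \<open>Conversion to the Srivastava--Daoust function\<close>

lemma pochhammer_minus_of_nat:
  assumes "k \<le> m"
  shows "pochhammer (- of_nat m) k = ((- 1) ^ k * fact m / fact (m - k) :: 'a :: field_char_0)"
proof -
  have "pochhammer (- of_nat m :: 'a) k = (- 1) ^ k * (fact k * of_nat (m choose k))"
    using gbinomial_pochhammer[of "of_nat m :: 'a" k]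
    by (simp add: binomial_gbinomial flip: mult.assoc power_mult_distrib)
  also have "fact k * of_nat (m choose k) = (fact m / fact (m - k) :: 'a)"
    using assms by (simp add: binomial_fact)
  finally show ?thesis
    by simp
qed

text \<open>The finite sums agree term by term once \<open>v ^ m / fact m\<close> is taken out:
  \<open>pochhammer (- of_nat m)\<close> supplies the factorial quotient and a sign, and the scaled
  arguments supply the missing powers of \<open>v\<close>.\<close>

lemma frakE_eq_srivastava_daoust:
  assumes v: "v \<noteq> 0" and len: "length x = length b"
  shows "frakE m b x v w =
    v ^ m / fact m * srivastava_daoust m b (map (\<lambda>y. - y / v) x) (w / v\<^sup>2)"
proof -
  let ?S = "{(\<alpha> :: nat list, a :: nat). length \<alpha> = length b \<and> sum_list \<alpha> + 2 * a \<le> m}"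
  let ?f = "\<lambda>\<alpha> a. pochhammer (- of_nat m) (sum_list \<alpha> + 2 * a) *
    (\<Prod>h<length b. pochhammer (b ! h) (\<alpha> ! h) / fact (\<alpha> ! h) * (map (\<lambda>y. - y / v) x ! h) ^ (\<alpha> ! h)) *
    (1 / fact a) * (w / v\<^sup>2) ^ a"
  have "srivastava_daoust m b (map (\<lambda>y. - y / v) x) (w / v\<^sup>2) = (\<Sum>\<^sub>\<infinity>(\<alpha>, a)\<in>?S. ?f \<alpha> a)"
    unfolding srivastava_daoust_def
    \<comment> \<open>Outside the finite index set the rising factorial of \<open>- of_nat m\<close>
      vanishes.\<close>
    by (rule infsum_cong_neutral) (auto simp: pochhammer_of_nat_eq_0_iff)
  also have "\<dots> = (\<Sum>(\<alpha>, a)\<in>?S. ?f \<alpha> a)"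
    by (rule infsum_finite[OF finite_frakE_indices])
  finally have sd: "srivastava_daoust m b (map (\<lambda>y. - y / v) x) (w / v\<^sup>2) =
    (\<Sum>(\<alpha>, a)\<in>?S. ?f \<alpha> a)" .
  have "v ^ (m - sum_list \<alpha> - 2 * a) * w ^ a / (fact (m - sum_list \<alpha> - 2 * a) * fact a) *
      (\<Prod>h<length b. pochhammer (b ! h) (\<alpha> ! h) * (x ! h) ^ (\<alpha> ! h) / fact (\<alpha> ! h)) =
      v ^ m / fact m * ?f \<alpha> a"
    if \<alpha>: "length \<alpha> = length b" and le: "sum_list \<alpha> + 2 * a \<le> m" for \<alpha> a
  proof -
    let ?Q = "\<Prod>h<length b. pochhammer (b ! h) (\<alpha> ! h) * (x ! h) ^ (\<alpha> ! h) / fact (\<alpha> ! h)"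
    define s where "s = sum_list \<alpha>"
    have "(\<Prod>h<length b. pochhammer (b ! h) (\<alpha> ! h) / fact (\<alpha> ! h) * (map (\<lambda>y. - y / v) x ! h) ^ (\<alpha> ! h)) =
      (\<Prod>h<length b. pochhammer (b ! h) (\<alpha> ! h) * (x ! h) ^ (\<alpha> ! h) / fact (\<alpha> ! h) * (- 1 / v) ^ (\<alpha> ! h))"
      using len by (intro prod.cong) (auto simp: power_divide power_minus' power_minus[of "_ ! _"] mult_ac)
    also have "\<dots> = ?Q * (- 1 / v) ^ s"
      by (simp only: prod.distrib power_sum s_def sum_list_sum_nth atLeast0LessThan \<alpha>)
    finally have Q: "?f \<alpha> a = (- 1) ^ (s + 2 * a) * fact m / fact (m - (s + 2 * a)) *
        (?Q * (- 1 / v) ^ s) * (1 / fact a) * (w / v\<^sup>2) ^ a"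
      using le by (simp add: pochhammer_minus_of_nat s_def)
    \<comment> \<open>The exponents \<open>s + 2 * a\<close> and \<open>s\<close> have the same
      parity, so the signs cancel.\<close>
    have sgn: "(- 1) ^ (s + 2 * a) * (- 1 / v) ^ s = (1 / v ^ s :: complex)"
      by (simp add: power_add power_mult power_divide flip: power_mult_distrib)
    \<comment> \<open>The three powers are the one kept in \<open>frakE\<close>, the denominators of
      the arguments \<open>- x\<^sub>h / v\<close>, and the denominator of
      \<open>w / v\<^sup>2\<close>.\<close>
    have vm: "v ^ m = v ^ (m - (s + 2 * a)) * v ^ s * (v\<^sup>2) ^ a"
      using le by (simp add: s_def flip: power_add power_mult)
    have "v ^ m / fact m * ?f \<alpha> a = v ^ m / fact m *
        (((- 1) ^ (s + 2 * a) * (- 1 / v) ^ s) * fact m / fact (m - (s + 2 * a)) *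
        ?Q * (1 / fact a) * (w / v\<^sup>2) ^ a)"
      unfolding Q by (simp add: mult_ac)
    also have "\<dots> = v ^ (m - (s + 2 * a)) * w ^ a / (fact (m - (s + 2 * a)) * fact a) * ?Q"
      unfolding sgn vm using v by (simp add: power_divide field_simps)
    finally show ?thesis
      by (simp add: s_def)
  qed
  then show ?thesis
    unfolding sd frakE_def sum_distrib_left by (intro sum.cong) auto
qed

section \<open>The residue as a coefficient, and the local factors of the integrand\<close>

lemma residue_eq_fps_nth:
  assumes g: "g has_fps_expansion F"
    and f: "eventually (\<lambda>s. f (z + s) = g s / s ^ Suc n) (at 0)"
  shows "residue f z = fps_nth F n"
proof -
  have "(\<lambda>s. g s / s ^ Suc n) has_laurent_expansion fps_to_fls F / fls_X ^ Suc n"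
    by (intro laurent_expansion_intros has_laurent_expansion_fps g)
  then have "(\<lambda>s. f (z + s)) has_laurent_expansion fps_to_fls F / fls_X ^ Suc n"
    using f by (subst has_laurent_expansion_cong[OF _ refl]) auto
  then have "residue f z = fls_residue (fps_to_fls F / fls_X ^ Suc n)"
    by (rule has_laurent_expansion_residue)
  also have "\<dots> = fps_nth F n"
    \<comment> \<open>Division by the power \<open>Suc n\<close> of the variable shifts indices, so
      the coefficient of index \<open>- 1\<close> is the old one of index \<open>n\<close>.\<close>
    by (simp add: fls_X_power_conv_shift_1 fls_divide_shift_denom_nonzero del: power_Suc)
  finally show ?thesis .
qed

text \<open>Here \<open>c\<close> stands for \<open>\<rho>\<^sub>h + \<xi>\<^sub>i\<close>. Writing
  \<open>c + s = c * y\<close> with \<open>Re y > 0\<close> keeps \<open>y\<close> off the branch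
  cut, so the positive constant can be pulled out of the principal power and inversion commutes with
  it. The numerator power and the power from \<open>hermite_L\<close> then merge into one of
  exponent \<open>n + d\<close>.\<close>

lemma powr_factor_shift:
  assumes \<rho>: "\<rho> > 0" and c: "c > 0" and s: "cmod s < c"
  shows "(of_real c + s) ^ n / (of_real \<rho> / (of_real c + s)) powr of_real d =
    of_real c powr of_real (real n + d) / of_real (\<rho> powr d) *
    (1 - - 1 / of_real c * s) powr (- (- of_nat n - of_real d))"
proof -
  define y where "y = 1 + s / of_real c"
  have "cmod (s / of_real c) < 1"
    using c s by (simp add: norm_divide)
  then have "- Re (s / of_real c) < 1"
    using abs_Re_le_cmod[of "s / of_real c"] by linarith
  then have Re: "Re y > 0"
    by (simp add: y_def)
  then have y0: "y \<noteq> 0" and yn: "y \<notin> \<real>\<^sub>\<le>\<^sub>0"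
    by (auto simp: complex_nonpos_Reals_iff)
  have cs: "of_real c + s = of_real c * y"
    using c by (simp add: y_def field_simps)
  have "(of_real \<rho> / (of_real c + s)) powr of_real d =
      (of_real (\<rho> / c) * inverse y) powr of_real d"
    unfolding cs using c by (simp add: field_simps)
  also have "\<dots> = of_real (\<rho> / c) powr of_real d * inverse y powr of_real d"
    using \<rho> c by (intro powr_times_real_left) auto
  also have "of_real (\<rho> / c) powr of_real d = (of_real ((\<rho> / c) powr d) :: complex)"
    using \<rho> c by (intro powr_of_real) auto
  also have "inverse y powr of_real d = inverse (y powr of_real d)"
    using y0 yn by (simp add: powr_def Ln_inverse exp_minus)
  finally have pw: "(of_real \<rho> / (of_real c + s)) powr of_real d =
      of_real ((\<rho> / c) powr d) * inverse (y powr of_real d)" .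
  have yp: "y powr (- (- of_nat n - of_real d)) = y ^ n * y powr of_real d"
    using y0 by (simp add: powr_add powr_nat')
  have cp: "(of_real c :: complex) powr of_real (real n + d) = of_real (c ^ n * c powr d)"
    using c by (subst powr_of_real) (auto simp: powr_add powr_realpow)
  have "(of_real c + s) ^ n / (of_real \<rho> / (of_real c + s)) powr of_real d =
    of_real (c ^ n * c powr d) / of_real (\<rho> powr d) * (y ^ n * y powr of_real d)"
    unfolding pw unfolding cs using \<rho> c
    by (simp add: powr_divide power_mult_distrib field_simps)
  then show ?thesis
    unfolding cp using yp by (simp add: y_def)
qed

text \<open>Gives the other poles the same form \<open>(1 - x s) powr (- b)\<close> as the factors
  above. The bound on \<open>s\<close> makes the base nonzero, where \<open>powr\<close> with
  integer exponent is the ordinary power; this matters even for \<open>k = 0\<close>, as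
  \<open>0 powr 0 = 0\<close>.\<close>

lemma power_factor_shift:
  assumes c: "c \<noteq> 0" and s: "cmod s < cmod c"
  shows "1 / (c - s) ^ k = 1 / c ^ k * (1 - 1 / c * s) powr (- of_nat k)"
proof -
  have "1 - s / c \<noteq> 0"
    using c s by auto
  then have "(1 - s / c) powr (- of_nat k) = 1 / (1 - s / c) ^ k"
    by (simp add: powr_minus powr_nat' divide_inverse)
  moreover have "(c - s) ^ k = c ^ k * (1 - s / c) ^ k"
    using c by (simp add: field_simps flip: power_mult_distrib)
  ultimately show ?thesis
    by simp
qed

section \<open>The concatenated parameter lists\<close>

text \<open>There are \<open>r\<close> entries from the \<open>\<rho>\<^sub>h\<close> and
  \<open>p - 1\<close> from the other poles; the quadratic exponential adds one more argument, which
  makes \<open>r + p\<close>.\<close>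

lemma length_hermite_lists:
  assumes "i \<in> {1..p}"
  shows "length (hermite_b r d p n m i) + 1 = r + p" "length (hermite_x r \<rho> p \<xi> i) + 1 = r + p"
proof -
  have "length (filter (\<lambda>k. k \<noteq> i) [1..<Suc p]) = card ({1..p} - {i})"
    by (subst distinct_card[symmetric]) (auto intro!: arg_cong[of _ _ card])
  then show "length (hermite_b r d p n m i) + 1 = r + p" "length (hermite_x r \<rho> p \<xi> i) + 1 = r + p"
    using assms by (auto simp: hermite_b_def hermite_x_def)
qed

text \<open>Both lists are maps over the same index lists, so entries at equal positions belong to
  the same factor of the integrand.\<close>

lemma prod_hermite_lists:
  fixes f :: "complex \<Rightarrow> complex \<Rightarrow> 'a :: comm_monoid_mult"
  shows "(\<Prod>j<length (hermite_b r d p n m i). f (hermite_b r d p n m i ! j) (hermite_x r \<rho> p \<xi> i ! j)) =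
    (\<Prod>h\<in>{1..r}. f (- of_nat (n h) - of_real (d h)) (- 1 / of_real (\<rho> h + \<xi> i))) *
    (\<Prod>k\<in>{1..p} - {i}. f (of_nat (m k)) (1 / of_real (\<xi> k - \<xi> i)))"
proof -
  let ?b = "hermite_b r d p n m i" and ?x = "hermite_x r \<rho> p \<xi> i"
  let ?K = "filter (\<lambda>k. k \<noteq> i) [1..<Suc p]"
  have len: "length ?b = length ?x"
    by (simp add: hermite_b_def hermite_x_def)
  have "(\<Prod>j<length ?b. f (?b ! j) (?x ! j)) = prod_list (map2 f ?b ?x)"
    using len by (subst prod.list_conv_set_nth) (auto simp: atLeast0LessThan intro!: prod.cong)
  also have "map2 f ?b ?x =
    map (\<lambda>h. f (- of_nat (n h) - of_real (d h)) (- 1 / of_real (\<rho> h + \<xi> i))) [1..<Suc r] @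
    map (\<lambda>k. f (of_nat (m k)) (1 / of_real (\<xi> k - \<xi> i))) ?K"
    by (simp add: hermite_b_def hermite_x_def zip_map_map zip_same_conv_map del: upt_Suc)
  also have "prod_list \<dots> =
    (\<Prod>h\<in>set [1..<Suc r]. f (- of_nat (n h) - of_real (d h)) (- 1 / of_real (\<rho> h + \<xi> i))) *
    (\<Prod>k\<in>set ?K. f (of_nat (m k)) (1 / of_real (\<xi> k - \<xi> i)))"
    by (simp add: prod.distinct_set_conv_list del: upt_Suc set_upt set_filter)
  also have "set [1..<Suc r] = {1..r}"
    by auto
  also have "set ?K = {1..p} - {i}"
    by auto
  finally show ?thesis .
qed

section \<open>Expansion of the integrand at a pole and its residue\<close>

lemma eventually_norm_less_at_0: "e > 0 \<Longrightarrow> eventually (\<lambda>s :: complex. cmod s < e) (at 0)"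
  using eventually_at_ball[of e "0 :: complex" UNIV] by (simp add: dist_norm)

text \<open>The bounds keep \<open>s\<close> closer to 0 than the distance from
  \<open>\<xi>\<^sub>i\<close> to any \<open>- \<rho>\<^sub>h\<close> or other pole, so the shift
  lemmas apply to every factor.\<close>

lemma hermite_integrand_shift:
  fixes \<xi> :: "nat \<Rightarrow> real"
  assumes \<rho>: "\<And>h. h \<in> {1..r} \<Longrightarrow> \<rho> h > 0"
    and c: "\<And>h. h \<in> {1..r} \<Longrightarrow> \<rho> h + \<xi> i > 0" and i: "i \<in> {1..p}" and mi: "m i \<ge> 1"
    and \<Delta>: "\<And>k. k \<in> {1..p} - {i} \<Longrightarrow> \<xi> k \<noteq> \<xi> i"
    and sr: "\<And>h. h \<in> {1..r} \<Longrightarrow> cmod s < \<rho> h + \<xi> i"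
    and sp: "\<And>k. k \<in> {1..p} - {i} \<Longrightarrow> cmod s < \<bar>\<xi> k - \<xi> i\<bar>"
  shows "hermite_integrand r \<rho> d a p \<xi> n m t (of_real (\<xi> i) + s) =
    exp (of_real (\<xi> i) * t) *
    ((- 1) ^ m i * exp (- of_real a * of_real (\<xi> i) - (of_real (\<xi> i))\<^sup>2 / 4) *
     hermite_G r \<rho> d p \<xi> n m i (of_real (\<xi> i)) / of_real (\<Prod>h\<in>{1..r}. \<rho> h powr d h)) *
    ((\<Prod>j<length (hermite_b r d p n m i).
        (1 - hermite_x r \<rho> p \<xi> i ! j * s) powr (- hermite_b r d p n m i ! j)) *
     (exp (- 1 / 4 * s\<^sup>2) * exp (hermite_u a \<xi> i t * s))) / s ^ Suc (m i - 1)"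
proof -
  let ?z = "of_real (\<xi> i) + s"
  let ?I = "{1..r}" and ?K = "{1..p} - {i}"
  have P: "(\<Prod>h\<in>?I. (of_real (\<rho> h) + ?z) ^ n h) /
      (\<Prod>h\<in>?I. (of_real (\<rho> h) / (of_real (\<rho> h) + ?z)) powr of_real (d h)) =
    (\<Prod>h\<in>?I. (of_real (\<rho> h) + of_real (\<xi> i)) powr of_real (real (n h) + d h)) /
      of_real (\<Prod>h\<in>?I. \<rho> h powr d h) *
    (\<Prod>h\<in>?I. (1 - - 1 / of_real (\<rho> h + \<xi> i) * s) powr (- (- of_nat (n h) - of_real (d h))))"
    unfolding of_real_prod prod_dividef[symmetric] prod.distrib[symmetric]
    using powr_factor_shift[OF \<rho> c sr]
    by (intro prod.cong refl) (simp add: add.assoc)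
  have K: "1 / (\<Prod>k\<in>?K. (of_real (\<xi> k) - ?z) ^ m k) =
    1 / (\<Prod>k\<in>?K. (of_real (\<xi> k) - of_real (\<xi> i)) ^ m k) *
    (\<Prod>k\<in>?K. (1 - 1 / of_real (\<xi> k - \<xi> i) * s) powr (- of_nat (m k)))"
  proof -
    have "1 / (of_real (\<xi> k) - ?z) ^ m k = 1 / (of_real (\<xi> k) - of_real (\<xi> i)) ^ m k *
        (1 - 1 / of_real (\<xi> k - \<xi> i) * s) powr (- of_nat (m k))" if "k \<in> ?K" for k
    proof -
      have "cmod s < cmod (of_real (\<xi> k - \<xi> i))"
        using sp[OF that] by (simp only: norm_of_real)
      then show ?thesis
        using power_factor_shift[of "of_real (\<xi> k - \<xi> i)" s "m k"] \<Delta>[OF that]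
        by (simp add: diff_diff_add)
    qed
    then show ?thesis
      by (simp add: divide_inverse prod.distrib flip: prod_inversef)
  qed
  \<comment> \<open>The factor at the pole itself is \<open>- s\<close>; this is the origin of the
    sign \<open>(- 1) ^ m i\<close>.\<close>
  have F: "(\<Prod>k\<in>{1..p}. (of_real (\<xi> k) - ?z) ^ m k) =
      (- 1) ^ m i * s ^ m i * (\<Prod>k\<in>?K. (of_real (\<xi> k) - ?z) ^ m k)"
    using i by (subst prod.remove[of _ i]) (simp_all add: power_minus[of s])
  \<comment> \<open>Expanding \<open>z t - a z - z\<^sup>2 / 4\<close> at
    \<open>\<xi>\<^sub>i\<close> gives the linear coefficient
    \<open>t - a - \<xi>\<^sub>i / 2\<close>, which is \<open>hermite_u\<close>, and the quadratic
    coefficient \<open>- 1 / 4\<close>.\<close>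
  have E: "exp (?z * t) / exp (of_real a * ?z + ?z\<^sup>2 / 4) =
    exp (of_real (\<xi> i) * t) * exp (- of_real a * of_real (\<xi> i) - (of_real (\<xi> i))\<^sup>2 / 4) *
    (exp (- 1 / 4 * s\<^sup>2) * exp (hermite_u a \<xi> i t * s))"
    unfolding exp_add[symmetric] exp_diff[symmetric]
    by (rule arg_cong[of _ _ exp]) (simp add: hermite_u_def power2_eq_square field_simps)
  have "inverse ((- 1) ^ m i) = ((- 1) ^ m i :: complex)"
    by (simp flip: power_inverse)
  \<comment> \<open>Valid for all values, since \<open>x / 0 = 0\<close>; this covers
    \<open>s = 0\<close>.\<close>
  then have rearrange: "e * A / (x * B * ((- 1) ^ m i * y * Q)) =
      e / x * (A / B) * (1 / Q) * (- 1) ^ m i / y"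
    for e A x B y Q :: complex
    by (simp add: divide_inverse mult_ac)
  have "hermite_integrand r \<rho> d a p \<xi> n m t ?z =
    (exp (?z * t) / exp (of_real a * ?z + ?z\<^sup>2 / 4)) *
    ((\<Prod>h\<in>?I. (of_real (\<rho> h) + ?z) ^ n h) /
      (\<Prod>h\<in>?I. (of_real (\<rho> h) / (of_real (\<rho> h) + ?z)) powr of_real (d h))) *
    (1 / (\<Prod>k\<in>?K. (of_real (\<xi> k) - ?z) ^ m k)) * (- 1) ^ m i / s ^ m i"
    unfolding hermite_integrand_def hermite_L_def F by (rule rearrange)
  moreover have "Suc (m i - 1) = m i"
    using mi by simp
  ultimately show ?thesis
    unfolding E P K prod_hermite_lists[of "\<lambda>b x. (1 - x * s) powr (- b)"] hermite_G_def
    by (simp only: times_divide_eq_left times_divide_eq_right divide_divide_eq_left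
        mult_1_left mult_1_right mult_ac)
qed

lemma hermite_A_eq_frakE:
  fixes \<xi> :: "nat \<Rightarrow> real"
  assumes \<rho>: "\<And>h. h \<in> {1..r} \<Longrightarrow> \<rho> h > 0"
    and c: "\<And>h. h \<in> {1..r} \<Longrightarrow> \<rho> h + \<xi> i > 0" and i: "i \<in> {1..p}" and mi: "m i \<ge> 1"
    and \<Delta>: "\<And>k. k \<in> {1..p} - {i} \<Longrightarrow> \<xi> k \<noteq> \<xi> i"
  shows "hermite_A r \<rho> d a p \<xi> n m i t =
    (- 1) ^ m i * exp (- of_real a * of_real (\<xi> i) - (of_real (\<xi> i))\<^sup>2 / 4) *
     hermite_G r \<rho> d p \<xi> n m i (of_real (\<xi> i)) / of_real (\<Prod>h\<in>{1..r}. \<rho> h powr d h) *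
    frakE (m i - 1) (hermite_b r d p n m i) (hermite_x r \<rho> p \<xi> i) (hermite_u a \<xi> i t) (- 1 / 4)"
proof -
  define C where "C = (- 1) ^ m i * exp (- of_real a * of_real (\<xi> i) - (of_real (\<xi> i))\<^sup>2 / 4) *
     hermite_G r \<rho> d p \<xi> n m i (of_real (\<xi> i)) / of_real (\<Prod>h\<in>{1..r}. \<rho> h powr d h)"
  let ?b = "hermite_b r d p n m i" and ?x = "hermite_x r \<rho> p \<xi> i" and ?u = "hermite_u a \<xi> i t"
  let ?g = "\<lambda>s. (\<Prod>j<length ?b. (1 - ?x ! j * s) powr (- ?b ! j)) *
     (exp (- 1 / 4 * s\<^sup>2) * exp (?u * s))"
  let ?F = "(\<Prod>j<length ?b. pochhammer_fps (?b ! j) (?x ! j)) *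
     ((fps_exp (- 1 / 4) oo fps_X ^ 2) * fps_exp ?u)"
  have "((\<lambda>s. exp (- 1 / 4 * s)) \<circ> (\<lambda>s. s ^ 2)) has_fps_expansion (fps_exp (- 1 / 4 :: complex) oo fps_X ^ 2)"
    by (intro has_fps_expansion_compose has_fps_expansion_exp has_fps_expansion_fps_X_power) simp
  then have g: "?g has_fps_expansion ?F"
    unfolding o_def
    by (intro has_fps_expansion_mult has_fps_expansion_prod has_fps_expansion_pochhammer_fps
        has_fps_expansion_exp)
  have "eventually (\<lambda>s. \<forall>h\<in>{1..r}. cmod s < \<rho> h + \<xi> i) (at 0)"
    using c by (intro eventually_ball_finite ballI eventually_norm_less_at_0) auto
  moreover have "eventually (\<lambda>s. \<forall>k\<in>{1..p} - {i}. cmod s < \<bar>\<xi> k - \<xi> i\<bar>) (at 0)"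
    using \<Delta> by (intro eventually_ball_finite ballI eventually_norm_less_at_0) auto
  ultimately have "eventually (\<lambda>s. hermite_integrand r \<rho> d a p \<xi> n m t (of_real (\<xi> i) + s) =
      exp (of_real (\<xi> i) * t) * C * ?g s / s ^ Suc (m i - 1)) (at 0)"
    unfolding C_def
    by eventually_elim (rule hermite_integrand_shift; use \<rho> c i mi \<Delta> in blast)
  then have "residue (hermite_integrand r \<rho> d a p \<xi> n m t) (of_real (\<xi> i)) =
      fps_nth (fps_const (exp (of_real (\<xi> i) * t) * C) * ?F) (m i - 1)"
    by (rule residue_eq_fps_nth[OF has_fps_expansion_cmult_left[OF g]])
  \<comment> \<open>The factor \<open>exp (\<xi>\<^sub>i t)\<close> of the residue cancels against
    the one in \<open>hermite_A\<close>.\<close>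
  then show ?thesis
    unfolding frakE_eq_fps_nth C_def[symmetric] hermite_A_def by (simp add: exp_minus)
qed

section \<open>The explicit formula for the components\<close>

theorem proposition5p9:
  fixes r p :: nat
    and \<rho> d \<xi> :: "nat \<Rightarrow> real"
    and a :: real
    and n m :: "nat \<Rightarrow> nat"
    and \<eta> N :: nat
  assumes "p \<ge> 1"
    and "\<And>h. h \<in> {1..r} \<Longrightarrow> \<rho> h > 0"
    and "\<And>h. h \<in> {1..r} \<Longrightarrow> d h \<ge> 0"
    and "inj_on \<xi> {1..p}"
    and "\<And>i h. i \<in> {1..p} \<Longrightarrow> h \<in> {1..r} \<Longrightarrow> \<xi> i + \<rho> h > 0"
    and "\<And>x y. x \<in> set (map n [1..<Suc r] @ [\<eta>]) \<Longrightarrow> y \<in> set (map n [1..<Suc r] @ [\<eta>]) \<Longrightarrow> x \<le> y + 1"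
    and "N = (\<Sum>h\<in>{1..r}. n h) + \<eta>"
    and "(\<Sum>i\<in>{1..p}. m i) = N + 1"
  shows "\<forall>i\<in>{1..p}. m i \<ge> 1 \<longrightarrow>
    (let C = (- 1) ^ m i *
             exp (- of_real a * of_real (\<xi> i) - (of_real (\<xi> i))\<^sup>2 / 4) *
             hermite_G r \<rho> d p \<xi> n m i (of_real (\<xi> i)) /
             of_real (\<Prod>h\<in>{1..r}. \<rho> h powr d h);
         b = hermite_b r d p n m i;
         x = hermite_x r \<rho> p \<xi> i
     in (\<forall>t. hermite_A r \<rho> d a p \<xi> n m i t =
             C * frakE (m i - 1) b x (hermite_u a \<xi> i t) (- 1 / 4)) \<and>
        length b + 1 = r + p \<and> length x + 1 = r + p \<and>
        (\<forall>t. hermite_u a \<xi> i t \<noteq> 0 \<longrightarrow>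
             hermite_A r \<rho> d a p \<xi> n m i t =
             C * (hermite_u a \<xi> i t ^ (m i - 1) / fact (m i - 1) *
               srivastava_daoust (m i - 1) b (map (\<lambda>y. - y / hermite_u a \<xi> i t) x)
                 ((- 1 / 4) / (hermite_u a \<xi> i t)\<^sup>2))))"
proof (intro ballI impI)
  fix i assume i: "i \<in> {1..p}" and mi: "m i \<ge> 1"
  have A: "hermite_A r \<rho> d a p \<xi> n m i t =
    (- 1) ^ m i * exp (- of_real a * of_real (\<xi> i) - (of_real (\<xi> i))\<^sup>2 / 4) *
     hermite_G r \<rho> d p \<xi> n m i (of_real (\<xi> i)) / of_real (\<Prod>h\<in>{1..r}. \<rho> h powr d h) *
    frakE (m i - 1) (hermite_b r d p n m i) (hermite_x r \<rho> p \<xi> i) (hermite_u a \<xi> i t) (- 1 / 4)" for t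
    using assms(2) assms(5)[OF i] inj_onD[OF assms(4)] i mi
    by (intro hermite_A_eq_frakE) (auto simp: add.commute)
  note len = length_hermite_lists[OF i]
  have "length (hermite_x r \<rho> p \<xi> i) = length (hermite_b r d p n m i)"
    using len(1)[of r d n m] len(2)[of r \<rho> \<xi>] by simp
  note sd = frakE_eq_srivastava_daoust[OF _ this]
  show "(let C = (- 1) ^ m i *
             exp (- of_real a * of_real (\<xi> i) - (of_real (\<xi> i))\<^sup>2 / 4) *
             hermite_G r \<rho> d p \<xi> n m i (of_real (\<xi> i)) /
             of_real (\<Prod>h\<in>{1..r}. \<rho> h powr d h);
         b = hermite_b r d p n m i;
         x = hermite_x r \<rho> p \<xi> i
     in (\<forall>t. hermite_A r \<rho> d a p \<xi> n m i t =
             C * frakE (m i - 1) b x (hermite_u a \<xi> i t) (- 1 / 4)) \<and>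
        length b + 1 = r + p \<and> length x + 1 = r + p \<and>
        (\<forall>t. hermite_u a \<xi> i t \<noteq> 0 \<longrightarrow>
             hermite_A r \<rho> d a p \<xi> n m i t =
             C * (hermite_u a \<xi> i t ^ (m i - 1) / fact (m i - 1) *
               srivastava_daoust (m i - 1) b (map (\<lambda>y. - y / hermite_u a \<xi> i t) x)
                 ((- 1 / 4) / (hermite_u a \<xi> i t)\<^sup>2))))"
    unfolding Let_def using A len sd by simp
qed

end
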